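(* Let $x\in\mathbb{R}^d$ be drawn from the subspace clustering model with parameters $U_1,\dots,U_k\in\mathbb{R}^{d\times m}$, mixture weights $\alpha_1,\dots,\alpha_k$ and noise variance $\sigma^2$, with $d>mk$, and let $v\in\mathbb{R}^d$. Define $$M_2:=\mathbb{E}[xx^T],\qquad A:=M_2-\sigma^2I_d,$$ $$B:=\mathbb{E}[\langle x,v\rangle^2xx^T]-\sigma^2(v^TAv)I_d-\sigma^2\|v\|^2A-\sigma^4(\|v\|^2I_d+2vv^T)-2\sigma^2(Avv^T+vv^TA).$$ Then $\sigma^2=\sigma_{mk+1}(M_2)$ (the $(mk+1)$-th largest singular value of $M_2$), and $$A=\sum_{i=1}^k\alpha_iU_iU_i^T,$$ $$B=\sum_{i=1}^k\alpha_i\|U_i^Tv\|^2U_iU_i^T+2\sum_{i=1}^k\alpha_iU_iU_i^Tvv^TU_iU_i^T.$$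
   Context: Subspace clustering model: $U_1,\dots,U_k\in\mathbb{R}^{d\times m}$ have orthonormal columns, $\alpha_i>0$, $\sum_i\alpha_i=1$. An index $i$ is chosen with probability $\alpha_i$; independently $y\sim\mathcal{N}(0,I_d)$ and $\xi\sim\mathcal{N}(0,\sigma^2I_d)$ are drawn (independent of each other and of $i$), and $x=U_iU_i^Ty+\xi$. *)

theory Defs
  imports "HOL-Probability.Probability" "HOL-Computational_Algebra.Computational_Algebra"
begin

definition outer_prod :: "real ^ 'm \<Rightarrow> real ^ 'n \<Rightarrow> real ^ 'n ^ 'm" where
  "outer_prod v w = (\<chi> i j. v $ i * w $ j)"

definition orthonormal_columns :: "real ^ 'm ^ 'd \<Rightarrow> bool" where
  "orthonormal_columns U \<longleftrightarrow> transpose U ** U = mat 1"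

definition std_gaussian :: "(real ^ 'd) measure" where
  "std_gaussian = density lborel (\<lambda>z. ennreal (\<Prod>i\<in>UNIV. std_normal_density (z $ i)))"

(* N(0, s I) is the law of sqrt s * z for standard Gaussian z. A density is not used, because
   it does not exist for s = 0, where this measure is the point mass at the origin. *)
definition isotropic_gaussian :: "real \<Rightarrow> (real ^ 'd) measure" where
  "isotropic_gaussian s = distr std_gaussian borel (\<lambda>z. sqrt s *\<^sub>R z)"

definition events_of :: "'w measure \<Rightarrow> 'a measure \<Rightarrow> ('w \<Rightarrow> 'a) \<Rightarrow> 'w set set" where
  "events_of P N X = {X -` E \<inter> space P | E. E \<in> sets N}"

(* The library's indep_vars requires all variables to have the same value type; this is its
   definition with the three value types kept apart. *)
definition indep_vars3 ::
  "'w measure \<Rightarrow> 'a measure \<Rightarrow> ('w \<Rightarrow> 'a) \<Rightarrow> 'b measure \<Rightarrow> ('w \<Rightarrow> 'b) \<Rightarrow> 'c measure \<Rightarrow> ('w \<Rightarrow> 'c) \<Rightarrow> bool"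
where
  "indep_vars3 P N1 X1 N2 X2 N3 X3 \<longleftrightarrow>
     X1 \<in> measurable P N1 \<and> X2 \<in> measurable P N2 \<and> X3 \<in> measurable P N3 \<and>
     prob_space.indep_sets P
       (\<lambda>j. [events_of P N1 X1, events_of P N2 X2, events_of P N3 X3] ! j) {0, 1, 2 :: nat}"

(* P carries the latent variables: the component ix, the Gaussian vector y and the noise xi;
   x is the observed vector. *)
definition subspace_clustering_model ::
  "'w measure \<Rightarrow> ('k::finite \<Rightarrow> real ^ 'm ^ 'd) \<Rightarrow> ('k \<Rightarrow> real) \<Rightarrow> real \<Rightarrow>
   ('w \<Rightarrow> 'k) \<Rightarrow> ('w \<Rightarrow> real ^ 'd) \<Rightarrow> ('w \<Rightarrow> real ^ 'd) \<Rightarrow> ('w \<Rightarrow> real ^ 'd) \<Rightarrow> bool"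
where
  "subspace_clustering_model P U \<alpha> \<sigma> ix y \<xi> x \<longleftrightarrow>
     prob_space P \<and>
     (\<forall>i. orthonormal_columns (U i)) \<and>
     (\<forall>i. \<alpha> i > 0) \<and> (\<Sum>i\<in>UNIV. \<alpha> i) = 1 \<and>
     indep_vars3 P (count_space UNIV) ix borel y borel \<xi> \<and>
     (\<forall>i. measure P {w \<in> space P. ix w = i} = \<alpha> i) \<and>
     distr P borel y = isotropic_gaussian 1 \<and>
     distr P borel \<xi> = isotropic_gaussian (\<sigma>\<^sup>2) \<and>
     (\<forall>w \<in> space P. x w = (U (ix w) ** transpose (U (ix w))) *v y w + \<xi> w)"

definition char_poly_of :: "real ^ 'n ^ 'n \<Rightarrow> real poly" where
  "char_poly_of A = det (\<chi> i j. (if i = j then [:0, 1:] else 0) - [:A $ i $ j:])"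

(* Square roots of the eigenvalues of the Gram matrix, listed in decreasing order and with
   multiplicity. The Gram matrix is symmetric, so all its eigenvalues are real and the list
   has CARD('n) entries. *)
definition singular_values :: "real ^ 'n ^ 'n \<Rightarrow> real list" where
  "singular_values A =
     map sqrt (rev (sorted_list_of_multiset (proots (char_poly_of (transpose A ** A)))))"

(* The j-th largest singular value, counting from j = 1. *)
definition singular_value :: "nat \<Rightarrow> real ^ 'n ^ 'n \<Rightarrow> real" where
  "singular_value j A = singular_values A ! (j - 1)"

end

theory Submission
  imports Defs
begin

text \<open>
  Conditionally on the component \<open>i\<close>, the vector \<open>x\<close> is a centred Gaussian with covariance
  \<open>\<Sigma>\<^sub>i = U\<^sub>i U\<^sub>i\<^sup>T + \<sigma>\<^sup>2 I\<close>. So \<open>\<langle>x, u\<rangle>\<close> has conditional second moment \<open>u\<^sup>T \<Sigma>\<^sub>i u\<close> and fourth moment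
  \<open>3 (u\<^sup>T \<Sigma>\<^sub>i u)\<^sup>2\<close>, and by polarization
  \<open>E[\<langle>x, v\<rangle>\<^sup>2 x x\<^sup>T | i] = (v\<^sup>T \<Sigma>\<^sub>i v) \<Sigma>\<^sub>i + 2 \<Sigma>\<^sub>i v v\<^sup>T \<Sigma>\<^sub>i\<close>. Expanding \<open>\<Sigma>\<^sub>i\<close> and averaging over \<open>i\<close>, the correction
  terms in \<open>A\<close> and \<open>B\<close> remove exactly what involves \<open>\<sigma>\<close>. For the singular value, \<open>A\<close> is positive semidefinite
  and its range is spanned by the \<open>mk\<close> columns of the \<open>U\<^sub>i\<close>; hence in an orthonormal eigenbasis all but at
  most \<open>mk\<close> eigenvalues of \<open>M\<^sub>2 = A + \<sigma>\<^sup>2 I\<close> are \<open>\<sigma>\<^sup>2\<close>, and the others are larger.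
\<close>

section \<open>One-dimensional marginals of the isotropic Gaussian\<close>

lemma nn_integral_lborel_vec_prod:
  fixes f :: "'d::finite \<Rightarrow> real \<Rightarrow> ennreal"
  assumes [measurable]: "\<And>i. f i \<in> borel_measurable borel"
  shows "(\<integral>\<^sup>+z. (\<Prod>i\<in>UNIV. f i (z $ i)) \<partial>(lborel :: (real ^ 'd) measure)) = (\<Prod>i\<in>UNIV. \<integral>\<^sup>+t. f i t \<partial>lborel)"
proof -
  let ?ax = "\<lambda>i::'d. axis i (1::real)"
  have inj: "inj ?ax" by (auto simp: inj_on_def axis_eq_axis)
  have B: "(Basis :: (real ^ 'd) set) = range ?ax" by (auto simp: Basis_vec_def)
  have "(\<integral>\<^sup>+z. (\<Prod>b\<in>Basis. f (inv ?ax b) (z \<bullet> b)) \<partial>(lborel :: (real ^ 'd) measure))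
      = (\<Prod>b\<in>(Basis :: (real ^ 'd) set). \<integral>\<^sup>+t. f (inv ?ax b) t \<partial>lborel)"
    by (rule nn_integral_lborel_prod) auto
  then show ?thesis
    unfolding B by (simp add: prod.reindex[OF inj] inv_f_f[OF inj] inner_axis o_def)
qed

lemma sets_std_gaussian [simp, measurable_cong]: "sets std_gaussian = sets borel"
  and space_std_gaussian [simp]: "space std_gaussian = UNIV"
  by (simp_all add: std_gaussian_def)

abbreviation std_normal :: "real measure" where
  "std_normal \<equiv> density lborel (\<lambda>t. ennreal (std_normal_density t))"

text \<open>Density times indicator of a box factors over the coordinates, so Tonelli applies. Total
  mass, marginals and independence of the coordinates are all read off from this one
  formula.\<close>

lemma emeasure_std_gaussian_box:
  fixes E :: "'d::finite \<Rightarrow> real set"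
  assumes [measurable]: "\<And>i. E i \<in> sets borel"
  shows "emeasure std_gaussian {z :: real ^ 'd. \<forall>i. z $ i \<in> E i} = (\<Prod>i\<in>UNIV. emeasure std_normal (E i))"
proof -
  have [measurable]: "{z :: real ^ 'd. \<forall>i. z $ i \<in> E i} \<in> sets borel"
    by measurable
  have "ennreal (\<Prod>i\<in>UNIV. std_normal_density (z $ i)) * indicator {z. \<forall>i. z $ i \<in> E i} z
      = (\<Prod>i\<in>UNIV. ennreal (std_normal_density (z $ i)) * indicator (E i) (z $ i))" for z :: "real ^ 'd"
    by (auto simp: prod.distrib prod_ennreal indicator_def)
  then show ?thesis
    using nn_integral_lborel_vec_prod[of "\<lambda>i t. ennreal (std_normal_density t) * indicator (E i) t"]
    by (simp add: std_gaussian_def emeasure_density)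
qed

lemma emeasure_std_gaussian_coord:
  fixes E :: "real set" and i :: "'d::finite"
  assumes [measurable]: "E \<in> sets borel"
  shows "emeasure std_gaussian {z :: real ^ 'd. z $ i \<in> E} = emeasure std_normal E"
proof -
  interpret N: prob_space std_normal by (rule prob_space_normal_density) simp
  \<comment> \<open>A cylinder is a box with the full line in every other direction, and those
    factors have mass 1.\<close>
  have "{z :: real ^ 'd. z $ i \<in> E} = {z. \<forall>j. z $ j \<in> (if j = i then E else UNIV)}"
    by auto
  moreover have "(\<Prod>j\<in>UNIV. emeasure std_normal (if j = i then E else UNIV)) = emeasure std_normal E"
    using N.emeasure_space_1 by (subst prod.remove[of _ i]) (auto intro!: prod.neutral)
  ultimately show ?thesis
    by (simp add: emeasure_std_gaussian_box)
qed

lemma prob_space_std_gaussian: "prob_space (std_gaussian :: (real ^ 'd::finite) measure)"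
proof
  interpret N: prob_space std_normal by (rule prob_space_normal_density) simp
  show "emeasure std_gaussian (space std_gaussian :: (real ^ 'd) set) = 1"
    \<comment> \<open>Any coordinate serves to compute the total mass; \<open>undefined\<close>
      merely names one.\<close>
    using emeasure_std_gaussian_coord[of UNIV undefined] N.emeasure_space_1 by simp
qed

interpretation std_gaussian: prob_space "std_gaussian :: (real ^ 'd::finite) measure"
  by (rule prob_space_std_gaussian)

lemma distr_std_gaussian_coord:
  "distr std_gaussian borel (\<lambda>z :: real ^ 'd::finite. z $ i) = std_normal"
proof (rule measure_eqI)
  fix E assume "E \<in> sets (distr std_gaussian borel (\<lambda>z :: real ^ 'd. z $ i))"
  then have "E \<in> sets borel" by simp
  then show "emeasure (distr std_gaussian borel (\<lambda>z :: real ^ 'd. z $ i)) E = emeasure std_normal E"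
    by (simp add: emeasure_distr vimage_def emeasure_std_gaussian_coord[simplified])
qed simp

text \<open>The index type is finite and each family contains the whole space, so the product rule
  has to be checked only over all coordinates at once. There it is the box formula.\<close>

lemma indep_vars_std_gaussian:
  "std_gaussian.indep_vars (\<lambda>_. borel) (\<lambda>i z. z $ i) (UNIV :: 'd::finite set)"
proof -
  let ?F = "\<lambda>i. {(\<lambda>z :: real ^ 'd. z $ i) -` A \<inter> space std_gaussian | A. A \<in> sets borel}"
  have "std_gaussian.indep_sets ?F UNIV"
  proof (subst std_gaussian.indep_sets_finite)
    show "?F i \<subseteq> std_gaussian.events" for i
      using measurable_sets[of "\<lambda>z :: real ^ 'd. z $ i" borel borel] by auto
    show "space std_gaussian \<in> ?F i" for i
      by (auto intro!: exI[of _ UNIV])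
    show "\<forall>A\<in>Pi UNIV ?F. std_gaussian.prob (\<Inter>j\<in>UNIV. A j) = (\<Prod>j\<in>UNIV. std_gaussian.prob (A j))"
    proof
      fix A assume "A \<in> Pi UNIV ?F"
      then have "\<forall>i. \<exists>E. A i = {z. z $ i \<in> E} \<and> E \<in> sets borel"
        by (auto simp: Pi_iff vimage_def)
      then obtain E where A: "\<And>i. A i = {z. z $ i \<in> E i}" and E: "\<And>i. E i \<in> sets borel"
        by metis
      have "(\<Inter>j\<in>UNIV. A j) = {z. \<forall>i. z $ i \<in> E i}"
        by (auto simp: A)
      then have "emeasure std_gaussian (\<Inter>j\<in>UNIV. A j) = (\<Prod>j\<in>UNIV. emeasure std_gaussian (A j))"
        by (simp add: A E emeasure_std_gaussian_box emeasure_std_gaussian_coord)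
      then show "std_gaussian.prob (\<Inter>j\<in>UNIV. A j) = (\<Prod>j\<in>UNIV. std_gaussian.prob (A j))"
        by (simp add: std_gaussian.emeasure_eq_measure prod_ennreal prod_nonneg)
    qed
  qed auto
  then show ?thesis
    unfolding std_gaussian.indep_vars_def2 by auto
qed

lemma distributed_std_gaussian_inner:
  fixes a :: "real ^ 'd::finite"
  assumes "a \<noteq> 0"
  shows "distributed std_gaussian lborel (\<lambda>z. z \<bullet> a) (normal_density 0 (norm a))"
proof -
  \<comment> \<open>A summand with coefficient 0 is a point mass and has no density. Dropping these
    summands leaves the inner product and the norm unchanged, and \<open>a\<close> being nonzero
    keeps the index set nonempty.\<close>
  let ?I = "{i. a $ i \<noteq> 0}"
  have I: "?I \<noteq> {}" using assms by (auto simp: vec_eq_iff)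
  have coord: "distributed std_gaussian lborel (\<lambda>z :: real ^ 'd. z $ i) std_normal_density" for i
    by (simp add: distributed_def distr_std_gaussian_coord cong: distr_cong)
  have "distributed std_gaussian lborel (\<lambda>z :: real ^ 'd. 0 + a $ i * z $ i) (normal_density (0 + a $ i * 0) (\<bar>a $ i\<bar> * 1))"
    if "i \<in> ?I" for i
    using that by (intro std_gaussian.normal_density_affine coord) auto
  moreover have "std_gaussian.indep_vars (\<lambda>_. borel) (\<lambda>i z. a $ i * z $ i) ?I"
    using std_gaussian.indep_vars_compose2[OF std_gaussian.indep_vars_subset[OF indep_vars_std_gaussian, of ?I],
        of "\<lambda>i t. a $ i * t" "\<lambda>_. borel"] by simp
  ultimately have "distributed std_gaussian lborel (\<lambda>z :: real ^ 'd. \<Sum>i\<in>?I. a $ i * z $ i)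
      (normal_density (\<Sum>i\<in>?I. 0) (sqrt (\<Sum>i\<in>?I. \<bar>a $ i\<bar>\<^sup>2)))"
    using I by (intro std_gaussian.sum_indep_normal) auto
  moreover have "(\<Sum>i\<in>?I. a $ i * z $ i) = z \<bullet> a" for z
    unfolding inner_vec_def by (auto intro!: sum.mono_neutral_cong_left)
  moreover have "sqrt (\<Sum>i\<in>?I. \<bar>a $ i\<bar>\<^sup>2) = norm a"
    unfolding norm_vec_def L2_set_def
    by (auto intro!: arg_cong[where f=sqrt] sum.mono_neutral_cong_left)
  ultimately show ?thesis by simp
qed

text \<open>For a unit vector the inner product is standard normal; homogeneity then supplies the
  factor \<open>norm a ^ n\<close>. The vector 0 has no direction and is treated apart, with
  \<open>0 ^ 0 = 1\<close> matching the total mass when \<open>n = 0\<close>.\<close>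

lemma has_bochner_integral_std_gaussian_inner_power:
  fixes a :: "real ^ 'd::finite"
  shows "has_bochner_integral std_gaussian (\<lambda>z. (z \<bullet> a) ^ n)
           (norm a ^ n * (\<integral>t. std_normal_density t * t ^ n \<partial>lborel))"
proof (cases "a = 0")
  case True
  have "(\<integral>t. std_normal_density t \<partial>lborel) = 1"
    by simp
  with True show ?thesis
    using std_gaussian.prob_space
    by (cases n) (auto simp: has_bochner_integral_iff)
next
  case False
  define u where "u = a /\<^sub>R norm a"
  have a: "a = norm a *\<^sub>R u" and u: "norm u = 1" "u \<noteq> 0"
    using False by (auto simp: u_def)
  have D: "distributed std_gaussian lborel (\<lambda>z. z \<bullet> u) std_normal_density"
    using distributed_std_gaussian_inner[OF u(2)] u(1) by simp
  have "integrable std_gaussian (\<lambda>z. (z \<bullet> u) ^ n)"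
    using distributed_integrable[OF D, of "\<lambda>t. t ^ n"] integrable_std_normal_moment[of n] by simp
  moreover have "(\<integral>z. (z \<bullet> u) ^ n \<partial>std_gaussian) = (\<integral>t. std_normal_density t * t ^ n \<partial>lborel)"
    using distributed_integral[OF D, of "\<lambda>t. t ^ n"] by simp
  ultimately have "has_bochner_integral std_gaussian (\<lambda>z. norm a ^ n * (z \<bullet> u) ^ n)
           (norm a ^ n * (\<integral>t. std_normal_density t * t ^ n \<partial>lborel))"
    by (simp add: has_bochner_integral_iff)
  then show ?thesis
    by (subst a) (simp add: power_mult_distrib)
qed

lemma std_normal_moments:
  "(\<integral>t. std_normal_density t * t \<partial>lborel) = 0"
  "(\<integral>t. std_normal_density t * t ^ 2 \<partial>lborel) = 1"
  "(\<integral>t. std_normal_density t * t ^ 3 \<partial>lborel) = 0"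
  "(\<integral>t. std_normal_density t * t ^ 4 \<partial>lborel) = 3"
  using integral_std_normal_moment_odd[of 0] integral_std_normal_moment_even[of 1]
    integral_std_normal_moment_odd[of 1] integral_std_normal_moment_even[of 2]
  by (simp_all add: fact_numeral)

text \<open>The law is an image of the standard Gaussian under scaling, so the moments transfer by
  two changes of variables. This also covers \<open>s = 0\<close>, where there is no
  density.\<close>

lemma isotropic_gaussian_inner_moments:
  fixes z :: "'w \<Rightarrow> real ^ 'd::finite" and a :: "real ^ 'd"
  assumes [measurable]: "z \<in> borel_measurable P"
    and z: "distr P borel z = isotropic_gaussian s" and s: "s \<ge> 0"
  shows "integrable P (\<lambda>w. (z w \<bullet> a) ^ n)"
    and "(\<integral>w. z w \<bullet> a \<partial>P) = 0"
    and "(\<integral>w. (z w \<bullet> a) ^ 2 \<partial>P) = s * (norm a)\<^sup>2"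
    and "(\<integral>w. (z w \<bullet> a) ^ 3 \<partial>P) = 0"
    and "(\<integral>w. (z w \<bullet> a) ^ 4 \<partial>P) = 3 * (s * (norm a)\<^sup>2)\<^sup>2"
proof -
  have "has_bochner_integral std_gaussian (\<lambda>x. ((sqrt s *\<^sub>R x) \<bullet> a) ^ n)
      (sqrt s ^ n * (norm a ^ n * (\<integral>t. std_normal_density t * t ^ n \<partial>lborel)))" for n
    using has_bochner_integral_mult_right[OF has_bochner_integral_std_gaussian_inner_power, of "sqrt s ^ n" a n]
    by (simp add: power_mult_distrib)
  then have "has_bochner_integral (distr P borel z) (\<lambda>x. (x \<bullet> a) ^ n)
      (sqrt s ^ n * (norm a ^ n * (\<integral>t. std_normal_density t * t ^ n \<partial>lborel)))" for n
    unfolding z isotropic_gaussian_def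
    by (simp add: has_bochner_integral_iff integrable_distr_eq integral_distr)
  then have *: "has_bochner_integral P (\<lambda>w. (z w \<bullet> a) ^ n)
      (sqrt s ^ n * (norm a ^ n * (\<integral>t. std_normal_density t * t ^ n \<partial>lborel)))" for n
    by (simp add: has_bochner_integral_iff integrable_distr_eq integral_distr)
  show "integrable P (\<lambda>w. (z w \<bullet> a) ^ n)"
    using * by (simp add: has_bochner_integral_iff)
  have s4: "sqrt s ^ 4 = s\<^sup>2"
    using s by (metis mult_2 numeral_Bit0 power2_eq_square power_mult real_sqrt_pow2)
  show "(\<integral>w. z w \<bullet> a \<partial>P) = 0"
    using *[of 1] by (simp add: has_bochner_integral_iff std_normal_moments)
  show "(\<integral>w. (z w \<bullet> a) ^ 2 \<partial>P) = s * (norm a)\<^sup>2"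
    using *[of 2] s by (simp add: has_bochner_integral_iff std_normal_moments)
  show "(\<integral>w. (z w \<bullet> a) ^ 3 \<partial>P) = 0"
    using *[of 3] by (simp add: has_bochner_integral_iff std_normal_moments)
  show "(\<integral>w. (z w \<bullet> a) ^ 4 \<partial>P) = 3 * (s * (norm a)\<^sup>2)\<^sup>2"
    using *[of 4] s4 by (simp add: has_bochner_integral_iff std_normal_moments power_mult_distrib)
qed

section \<open>Singular values and the spectral theorem\<close>

text \<open>Rayleigh quotient argument: the quadratic form of \<open>f\<close> attains its maximum
  on the compact unit sphere of \<open>S\<close>, and a maximizer is an eigenvector.\<close>

lemma self_adjoint_eigenvector:
  fixes f :: "'a::euclidean_space \<Rightarrow> 'a"
  assumes f: "linear f" and adj: "\<And>x y. x \<bullet> f y = f x \<bullet> y"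
    and S: "subspace S" and inv: "\<And>x. x \<in> S \<Longrightarrow> f x \<in> S" and nt: "\<exists>x\<in>S. x \<noteq> 0"
  obtains x c where "x \<in> S" "norm x = 1" "f x = c *\<^sub>R x"
proof -
  from f interpret linear f .
  obtain x0 where "x0 \<in> S" "x0 \<noteq> 0" using nt by blast
  then have "x0 /\<^sub>R norm x0 \<in> S \<inter> sphere 0 1"
    using subspace_scale[OF S] by auto
  then have ne: "S \<inter> sphere 0 1 \<noteq> {}" by blast
  have comp: "compact (S \<inter> sphere 0 1)"
    using closed_subspace[OF S] by (metis Int_commute compact_Int_closed compact_sphere)
  have cont: "continuous_on (S \<inter> sphere 0 1) (\<lambda>x. x \<bullet> f x)"
    using linear_continuous_on[of f] linear_axioms
    by (intro continuous_intros) (simp add: linear_conv_bounded_linear)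
  obtain x where x: "x \<in> S" "norm x = 1" and max: "\<And>z. z \<in> S \<Longrightarrow> norm z = 1 \<Longrightarrow> z \<bullet> f z \<le> x \<bullet> f x"
    using continuous_attains_sup[OF comp ne cont] by auto
  define c where "c = x \<bullet> f x"
  \<comment> \<open>\<open>g\<close> is nonnegative on \<open>S\<close> and vanishes at \<open>x\<close>, hence so does its derivative there, which is a
    multiple of \<open>c *\<^sub>R x - f x\<close>.\<close>
  define g where "g z = c * (z \<bullet> z) - z \<bullet> f z" for z
  have g: "g z \<ge> 0" if "z \<in> S" for z
  proof (cases "z = 0")
    case False
    have "(z /\<^sub>R norm z) \<bullet> f (z /\<^sub>R norm z) \<le> c"
      unfolding c_def using that False subspace_scale[OF S] by (intro max) auto
    then have "(z \<bullet> f z) / (norm z)\<^sup>2 \<le> c"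
      by (simp add: scale divide_simps power2_eq_square)
    with False show ?thesis
      by (simp add: g_def divide_simps power2_norm_eq_inner)
  qed (simp add: g_def zero)
  let ?y = "c *\<^sub>R x - f x"
  have y: "?y \<in> S" using x inv S by (intro subspace_diff subspace_scale) auto
  have "?y \<bullet> ?y = 0"
  proof (rule ccontr)
    assume "?y \<bullet> ?y \<noteq> 0"
    then have pos: "?y \<bullet> ?y > 0" by simp
    \<comment> \<open>A negative step for which the linear term of the expansion below beats the
      quadratic one: the two add up to \<open>- t\<^sup>2 * (g ?y + 2)\<close>. The 1 keeps the
      denominator positive when \<open>g ?y = 0\<close>.\<close>
    define t where "t = - (?y \<bullet> ?y) / (g ?y + 1)"
    have "g (x + t *\<^sub>R y) = g x + 2 * t * (y \<bullet> (c *\<^sub>R x - f x)) + t\<^sup>2 * g y" for y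
    proof -
      have "x \<bullet> f y = y \<bullet> f x" by (metis adj inner_commute)
      then show ?thesis
        by (simp add: g_def add scale inner_simps power2_eq_square algebra_simps inner_commute[of x y])
    qed
    then have "g (x + t *\<^sub>R ?y) = g x + 2 * t * (?y \<bullet> ?y) + t\<^sup>2 * g ?y" .
    moreover have "g x = 0"
      using x by (simp add: g_def c_def norm_eq_1)
    moreover have "g (x + t *\<^sub>R ?y) \<ge> 0"
      using x y S by (intro g subspace_add subspace_scale)
    moreover have "2 * t * (?y \<bullet> ?y) + t\<^sup>2 * g ?y < 0"
    proof -
      have gy: "g ?y \<ge> 0" using g[OF y] .
      then have yy: "?y \<bullet> ?y = - t * (g ?y + 1)" by (simp add: t_def)
      have "2 * t * (?y \<bullet> ?y) + t\<^sup>2 * g ?y = - (t\<^sup>2 * (g ?y + 2))"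
        unfolding yy by (simp only: power2_eq_square) algebra
      moreover have "t \<noteq> 0" using pos gy by (simp add: t_def)
      ultimately show ?thesis using gy by (simp add: mult_pos_pos)
    qed
    ultimately show False by linarith
  qed
  then have "f x = c *\<^sub>R x" by simp
  with x that show ?thesis by blast
qed

text \<open>Induction on the dimension: split off a unit eigenvector \<open>x\<close> and continue
  in its orthogonal complement within \<open>S\<close>. That complement is invariant because
  \<open>f z\<close> against \<open>x\<close> equals \<open>z\<close> against \<open>f x\<close>, a
  multiple of \<open>x\<close>.\<close>

lemma self_adjoint_eigenbasis:
  fixes f :: "'a::euclidean_space \<Rightarrow> 'a"
  assumes f: "linear f" and adj: "\<And>x y. x \<bullet> f y = f x \<bullet> y"
    and S: "subspace S" and inv: "\<And>x. x \<in> S \<Longrightarrow> f x \<in> S"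
  shows "\<exists>B. pairwise orthogonal B \<and> span B = S \<and> (\<forall>b\<in>B. norm b = 1 \<and> (\<exists>c. f b = c *\<^sub>R b))"
  using S inv
proof (induction "dim S" arbitrary: S rule: less_induct)
  case less
  show ?case
  proof (cases "\<exists>x\<in>S. x \<noteq> 0")
    case False
    then have "S = {0}" using subspace_0[OF less.prems(1)] by blast
    then show ?thesis by (intro exI[of _ "{}"]) auto
  next
    case True
    obtain x c where x: "x \<in> S" "norm x = 1" "f x = c *\<^sub>R x"
      using self_adjoint_eigenvector[OF f adj less.prems True] by blast
    let ?T = "{z \<in> S. x \<bullet> z = 0}"
    have T: "subspace ?T"
      using less.prems(1) by (auto simp: subspace_def inner_simps)
    have "x \<notin> ?T" using x by (simp add: norm_eq_1)
    then have "?T \<subset> S" using x(1) by blast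
    then have "dim ?T < dim S"
      by (metis T dim_psubset less.prems(1) span_eq_iff)
    moreover have "f z \<in> ?T" if "z \<in> ?T" for z
      using that x less.prems(2) by (simp add: adj)
    ultimately obtain B where B: "pairwise orthogonal B" "span B = ?T"
        "\<And>b. b \<in> B \<Longrightarrow> norm b = 1 \<and> (\<exists>c. f b = c *\<^sub>R b)"
      using less.hyps[of ?T] T by blast
    have BT: "B \<subseteq> ?T" using span_superset B(2) by blast
    have "pairwise orthogonal (insert x B)"
      using B(1) BT by (auto simp: pairwise_insert orthogonal_def inner_commute)
    moreover have "span (insert x B) = S"
    proof
      show "span (insert x B) \<subseteq> S"
        using x BT less.prems(1) by (intro span_minimal) auto
      show "S \<subseteq> span (insert x B)"
      proof
        fix z assume z: "z \<in> S"
        have "z - (x \<bullet> z) *\<^sub>R x \<in> ?T"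
          using z x less.prems(1) by (auto simp: inner_simps norm_eq_1 intro!: subspace_diff subspace_scale)
        then show "z \<in> span (insert x B)"
          unfolding span_insert B(2) by blast
      qed
    qed
    ultimately show ?thesis using x B(3) by (intro exI[of _ "insert x B"]) auto
  qed
qed

section \<open>Diagonalization and singular values of symmetric matrices\<close>

lemma matrix_vector_mult_adjoint:
  fixes A :: "real ^ 'n::finite ^ 'm::finite"
  shows "x \<bullet> (A *v y) = (transpose A *v x) \<bullet> y"
  by (simp add: dot_lmul_matrix[symmetric] inner_commute)

lemma symmetric_matrix_diagonalization:
  fixes A :: "real ^ 'n::finite ^ 'n"
  assumes sym: "transpose A = A"
  obtains Q c where "orthogonal_matrix Q" "\<And>j. A *v column j Q = c j *\<^sub>R column j Q"
proof -
  obtain B where B: "pairwise orthogonal B" "span B = UNIV"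
      "\<And>b. b \<in> B \<Longrightarrow> norm b = 1 \<and> (\<exists>c. A *v b = c *\<^sub>R b)"
    using self_adjoint_eigenbasis[of "(*v) A" UNIV] sym
    by (auto simp: matrix_vector_mult_adjoint)
  have "0 \<notin> B" using B(3) by force
  then have ind: "independent B" using B(1) pairwise_orthogonal_independent by blast
  \<comment> \<open>An independent spanning set has as many elements as there are coordinates, so
    the eigenbasis can be indexed by \<open>'n\<close> and stored as the columns of
    \<open>Q\<close>.\<close>
  then have card: "card B = CARD('n)" "finite B"
    using B(2) by (metis dim_UNIV dim_eq_card DIM_cart DIM_real mult_1_right dim_span) (metis ind independent_imp_finite)
  then obtain q where q: "bij_betw q (UNIV :: 'n set) B"
    by (metis finite finite_same_card_bij)
  define Q :: "real ^ 'n ^ 'n" where "Q = (\<chi> i j. q j $ i)"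
  have col: "column j Q = q j" for j by (simp add: Q_def column_def vec_eq_iff)
  have qB: "q j \<in> B" for j using q by (auto simp: bij_betw_def)
  have "orthogonal_matrix Q"
    unfolding orthogonal_matrix_orthonormal_columns col
    using B(1) qB B(3) bij_betw_imp_inj_on[OF q] by (auto simp: pairwise_def inj_eq)
  moreover have "\<forall>j. \<exists>c. A *v column j Q = c *\<^sub>R column j Q"
    using B(3) qB by (simp add: col)
  ultimately show ?thesis using that by metis
qed

text \<open>The relation A Q = Q D lifts to polynomial matrices as (X I - A) Q = Q (X I - D). Taking
  determinants and cancelling det Q, which is nonzero in an integral domain, leaves the diagonal
  determinant.\<close>

lemma char_poly_of_diagonalization:
  fixes A :: "real ^ 'n::finite ^ 'n"
  assumes Q: "orthogonal_matrix Q" and col: "\<And>j. A *v column j Q = c j *\<^sub>R column j Q"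
  shows "char_poly_of A = (\<Prod>j\<in>UNIV. [:- c j, 1:])"
proof -
  let ?X = "\<chi> i j. (if i = j then [:0, 1:] else 0) - [:A $ i $ j:] :: real poly ^ 'n ^ 'n"
  let ?C = "\<chi> i j. [:Q $ i $ j:] :: real poly ^ 'n ^ 'n"
  let ?D = "\<chi> i j. if i = j then [:- c j, 1:] else 0 :: real poly ^ 'n ^ 'n"
  have const_sum: "(\<Sum>k\<in>UNIV. [:f k:]) = [:\<Sum>k\<in>UNIV. f k:]" for f :: "'n \<Rightarrow> real"
    by (induction rule: infinite_finite_induct) auto
  have Aq: "(\<Sum>k\<in>UNIV. A $ i $ k * Q $ k $ j) = c j * Q $ i $ j" for i j
    using arg_cong[OF col[of j], of "\<lambda>v. v $ i"]
    by (simp add: matrix_vector_mult_def column_def)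
  have "?X ** ?C = ?C ** ?D"
  proof -
    have "(?X ** ?C) $ i $ j = (?C ** ?D) $ i $ j" for i j
    proof -
      have "(?X ** ?C) $ i $ j = (\<Sum>k\<in>UNIV. (if i = k then [:0, 1:] * [:Q $ k $ j:] else 0)) - (\<Sum>k\<in>UNIV. [:A $ i $ k * Q $ k $ j:])"
        unfolding sum_subtractf[symmetric]
        by (auto simp: matrix_matrix_mult_def intro!: sum.cong)
      also have "\<dots> = [:- c j * Q $ i $ j, Q $ i $ j:]"
        by (simp add: const_sum Aq)
      also have "\<dots> = (\<Sum>k\<in>UNIV. if k = j then [:Q $ i $ k:] * [:- c j, 1:] else 0)"
        by (subst sum.delta) auto
      also have "\<dots> = (?C ** ?D) $ i $ j"
        unfolding matrix_matrix_mult_def vec_lambda_beta by (rule sum.cong) auto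
      finally show ?thesis .
    qed
    then show ?thesis by (simp add: vec_eq_iff)
  qed
  then have "det (?X ** ?C) = det (?C ** ?D)"
    by (rule arg_cong)
  then have detXD: "det ?X * det ?C = det ?C * det ?D"
    unfolding det_mul .
  \<comment> \<open>Orthogonality survives the embedding of the reals as constant polynomials; it
    makes det \<open>?C\<close> a divisor of 1.\<close>
  have "transpose ?C ** ?C = mat 1"
  proof -
    have "transpose Q ** Q = mat 1" using Q by (simp add: orthogonal_matrix)
    then have "(\<Sum>k\<in>UNIV. Q $ k $ i * Q $ k $ j) = (if i = j then 1 else 0)" for i j
      by (simp add: vec_eq_iff matrix_matrix_mult_def transpose_def mat_def)
    then show ?thesis
      by (simp add: vec_eq_iff matrix_matrix_mult_def transpose_def mat_def const_sum one_pCons)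
  qed
  then have "det (transpose ?C) * det ?C = 1"
    unfolding det_mul[symmetric] by simp
  then have "det ?C \<noteq> 0"
    by (rule contrapos_pn) simp
  moreover have "p = r" if "p * q = q * r" "q \<noteq> 0" for p q r :: "real poly"
    using that by (simp add: mult.commute[of p])
  ultimately have "det ?X = det ?D"
    using detXD by blast
  also have "\<dots> = (\<Prod>j\<in>UNIV. [:- c j, 1:])"
    by (subst det_diagonal) auto
  finally show ?thesis by (simp add: char_poly_of_def)
qed

text \<open>The Gram matrix is the square of \<open>A\<close>, with the same eigenvectors and
  eigenvalues \<open>(c j)\<^sup>2\<close>. Nonnegativity makes the square root return
  \<open>c j\<close> itself; the multiset keeps multiplicities.\<close>

lemma singular_values_diagonalization:
  fixes A :: "real ^ 'n::finite ^ 'n"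
  assumes sym: "transpose A = A"
    and Q: "orthogonal_matrix Q" and col: "\<And>j. A *v column j Q = c j *\<^sub>R column j Q"
    and nonneg: "\<And>j. c j \<ge> 0"
  shows "mset (singular_values A) = image_mset c (mset_set UNIV)"
    and "sorted (rev (singular_values A))"
proof -
  have "(transpose A ** A) *v column j Q = (c j)\<^sup>2 *\<^sub>R column j Q" for j
    by (simp add: sym matrix_vector_mul_assoc[symmetric] col matrix_vector_mult_scaleR power2_eq_square)
  then have "char_poly_of (transpose A ** A) = (\<Prod>j\<in>UNIV. [:- (c j)\<^sup>2, 1:])"
    by (rule char_poly_of_diagonalization[OF Q])
  then have "proots (char_poly_of (transpose A ** A)) = (\<Sum>j\<in>UNIV. {#(c j)\<^sup>2#})"
    by (simp add: proots_prod)
  also have "\<dots> = image_mset (\<lambda>j. (c j)\<^sup>2) (mset_set UNIV)"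
    by (simp add: sum_unfold_sum_mset)
  finally show "mset (singular_values A) = image_mset c (mset_set UNIV)"
    using nonneg by (simp add: singular_values_def image_mset.compositionality o_def)
  show "sorted (rev (singular_values A))"
    by (simp add: singular_values_def rev_map sorted_map_mono sorted_map mono_def)
qed

text \<open>If entry \<open>r\<close> differed from the minimum \<open>s\<close>, it would exceed
  \<open>s\<close>, and so would all entries before it. These are \<open>r + 1\<close> entries, as
  positions start at 0, which is one too many.\<close>

lemma decreasing_nth_eq_lower_bound:
  fixes L :: "'a::linorder list"
  assumes "sorted (rev L)" "\<And>z. z \<in> set L \<Longrightarrow> s \<le> z"
    and "length (filter (\<lambda>z. z \<noteq> s) L) \<le> r" "r < length L"
  shows "L ! r = s"
proof (rule ccontr)
  assume ne: "L ! r \<noteq> s"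
  have "L ! i \<noteq> s" if "i \<le> r" for i
    using sorted_rev_nth_mono[OF assms(1) that assms(4)] assms(2)[of "L ! r"] assms(4) ne by auto
  then have "{..r} \<subseteq> {i. i < length L \<and> L ! i \<noteq> s}"
    using assms(4) by auto
  then have "card {..r} \<le> card {i. i < length L \<and> L ! i \<noteq> s}"
    by (intro card_mono) auto
  then show False
    using assms(3) by (simp add: length_filter_conv_card)
qed

text \<open>Eigenvectors with nonzero eigenvalue are independent and lie in the range of
  \<open>A\<close>, so there are at most \<open>r\<close> of them. Adding \<open>s\<close> times the
  identity keeps the eigenvectors and shifts every eigenvalue by \<open>s\<close>, so all but at
  most \<open>r\<close> become \<open>s\<close> and none is smaller.\<close>

lemma singular_value_low_rank_plus_identity:
  fixes A :: "real ^ 'n::finite ^ 'n"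
  assumes sym: "transpose A = A" and psd: "\<And>x. x \<bullet> (A *v x) \<ge> 0" and s: "s \<ge> 0"
    and rank: "dim (range ((*v) A)) \<le> r" "r < CARD('n)"
  shows "singular_value (r + 1) (A + s *\<^sub>R mat 1) = s"
proof -
  obtain Q c where Q: "orthogonal_matrix Q" and col: "\<And>j. A *v column j Q = c j *\<^sub>R column j Q"
    using symmetric_matrix_diagonalization[OF sym] by blast
  have unit: "norm (column j Q) = 1" for j
    using Q by (simp add: orthogonal_matrix_orthonormal_columns)
  have c: "c j \<ge> 0" for j
    using psd[of "column j Q"] unit[of j] by (simp add: col norm_eq_1)
  let ?M = "A + s *\<^sub>R mat 1" and ?J = "{j. c j \<noteq> 0}"
  have inj: "inj (\<lambda>j. column j Q)"
  proof (rule injI, rule ccontr)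
    fix i j assume "column i Q = column j Q" "i \<noteq> j"
    moreover have "orthogonal (column i Q) (column j Q)"
      using Q \<open>i \<noteq> j\<close> by (simp add: orthogonal_matrix_orthonormal_columns)
    ultimately show False using unit[of j] by (simp add: orthogonal_def norm_eq_1)
  qed
  have "independent ((\<lambda>j. column j Q) ` ?J)"
  proof (rule pairwise_orthogonal_independent)
    show "pairwise orthogonal ((\<lambda>j. column j Q) ` ?J)"
    proof (rule pairwiseI)
      fix u w assume "u \<in> (\<lambda>j. column j Q) ` ?J" "w \<in> (\<lambda>j. column j Q) ` ?J" "u \<noteq> w"
      then obtain i j where "u = column i Q" "w = column j Q" "i \<noteq> j" by blast
      then show "orthogonal u w"
        using Q by (simp add: orthogonal_matrix_orthonormal_columns)
    qed
    show "0 \<notin> (\<lambda>j. column j Q) ` ?J"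
    proof
      assume "0 \<in> (\<lambda>j. column j Q) ` ?J"
      then obtain j where "column j Q = 0" by auto
      then show False using unit[of j] by simp
    qed
  qed
  moreover have "(\<lambda>j. column j Q) ` ?J \<subseteq> range ((*v) A)"
  proof clarify
    fix j assume "c j \<noteq> 0"
    then have "column j Q = A *v (column j Q /\<^sub>R c j)"
      by (simp add: matrix_vector_mult_scaleR col)
    then show "column j Q \<in> range ((*v) A)" by blast
  qed
  ultimately have "card ((\<lambda>j. column j Q) ` ?J) \<le> dim (range ((*v) A))"
    using independent_card_le_dim by blast
  then have J: "card ?J \<le> r"
    using rank(1) by (simp add: card_image inj_on_subset[OF inj])
  have M: "?M *v column j Q = (c j + s) *\<^sub>R column j Q" for j
    by (simp add: matrix_vector_mult_add_rdistrib scaleR_matrix_vector_assoc[symmetric] col scaleR_add_left)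
  have symM: "transpose ?M = ?M"
    using sym by (auto simp: vec_eq_iff transpose_def mat_def)
  note L = singular_values_diagonalization[OF symM Q M]
  have L1: "mset (singular_values ?M) = image_mset (\<lambda>j. c j + s) (mset_set UNIV)"
    using c s by (intro L(1)) simp
  have "singular_values ?M ! r = s"
  proof (rule decreasing_nth_eq_lower_bound)
    show "sorted (rev (singular_values ?M))"
      using c s by (intro L(2)) simp
    have "set (singular_values ?M) = range (\<lambda>j. c j + s)"
      using arg_cong[OF L1, of set_mset] by simp
    then show "s \<le> z" if "z \<in> set (singular_values ?M)" for z
      using that c by auto
    \<comment> \<open>The count runs over indices, not over distinct values, so a repeated
      eigenvalue counts as often as it occurs.\<close>
    have "length (filter (\<lambda>z. z \<noteq> s) (singular_values ?M)) = size (filter_mset (\<lambda>z. z \<noteq> s) (mset (singular_values ?M)))"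
      by (metis mset_filter size_mset)
    also have "\<dots> = card ?J"
      unfolding L1 by (simp add: filter_mset_image_mset)
    finally show "length (filter (\<lambda>z. z \<noteq> s) (singular_values ?M)) \<le> r"
      using J by simp
    have "length (singular_values ?M) = CARD('n)"
      using arg_cong[OF L1, of size] by simp
    then show "r < length (singular_values ?M)"
      using rank(2) by simp
  qed
  then show ?thesis by (simp add: singular_value_def)
qed

section \<open>Moments of the subspace clustering model\<close>

text \<open>Composition with \<open>f\<close>, \<open>g\<close>, \<open>h\<close> brings the three
  variables to the common value type real, where \<open>indep_vars\<close> and its product rule for
  integrals apply.\<close>

lemma (in prob_space) indep_vars3_integral:
  fixes f :: "'b \<Rightarrow> real" and g :: "'c \<Rightarrow> real" and h :: "'d \<Rightarrow> real"
  assumes ind: "indep_vars3 M N1 X1 N2 X2 N3 X3"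
    and [measurable]: "f \<in> borel_measurable N1" "g \<in> borel_measurable N2" "h \<in> borel_measurable N3"
    and int: "integrable M (\<lambda>w. f (X1 w))" "integrable M (\<lambda>w. g (X2 w))" "integrable M (\<lambda>w. h (X3 w))"
  shows "has_bochner_integral M (\<lambda>w. f (X1 w) * (g (X2 w) * h (X3 w)))
     ((\<integral>w. f (X1 w) \<partial>M) * ((\<integral>w. g (X2 w) \<partial>M) * (\<integral>w. h (X3 w) \<partial>M)))"
proof -
  have [measurable]: "X1 \<in> measurable M N1" "X2 \<in> measurable M N2" "X3 \<in> measurable M N3"
    using ind by (auto simp: indep_vars3_def)
  define Y where "Y = (\<lambda>j::nat. [\<lambda>w. f (X1 w), \<lambda>w. g (X2 w), \<lambda>w. h (X3 w)] ! j)"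
  \<comment> \<open>Events of a composed variable are events of the original one, so independence
    passes to these smaller families.\<close>
  have comp: "{(\<lambda>w. k (X w)) -` E \<inter> space M | E. E \<in> sets borel} \<subseteq> events_of M N X"
    if "k \<in> borel_measurable N" "X \<in> measurable M N" for k :: "'e \<Rightarrow> real" and X N
  proof safe
    fix E :: "real set" assume "E \<in> sets borel"
    then have "k -` E \<inter> space N \<in> sets N" using that by measurable
    moreover have "(\<lambda>w. k (X w)) -` E \<inter> space M = X -` (k -` E \<inter> space N) \<inter> space M"
      using measurable_space[OF that(2)] by auto
    ultimately show "(\<lambda>w. k (X w)) -` E \<inter> space M \<in> events_of M N X"
      unfolding events_of_def by blast
  qed
  have "indep_sets (\<lambda>j. {Y j -` E \<inter> space M | E. E \<in> sets borel}) {0, 1, 2}"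
  proof (rule indep_sets_mono_sets)
    show "indep_sets (\<lambda>j. [events_of M N1 X1, events_of M N2 X2, events_of M N3 X3] ! j) {0, 1, 2 :: nat}"
      using ind by (simp add: indep_vars3_def)
    show "{Y j -` E \<inter> space M | E. E \<in> sets borel} \<subseteq> [events_of M N1 X1, events_of M N2 X2, events_of M N3 X3] ! j"
      if "j \<in> {0, 1, 2}" for j
      using that comp[OF assms(2)] comp[OF assms(3)] comp[OF assms(4)]
      by (elim insertE emptyE) (simp_all add: Y_def numeral_2_eq_2)
  qed
  then have Y: "indep_vars (\<lambda>_. borel) Y {0, 1, 2}"
    unfolding indep_vars_def2 by (auto simp: Y_def numeral_2_eq_2)
  have "integrable M (Y j)" if "j \<in> {0, 1, 2}" for j
    using that int by (auto simp: Y_def numeral_2_eq_2)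
  from indep_vars_lebesgue_integral[OF _ Y this] indep_vars_integrable[OF _ Y this]
  show ?thesis
    by (simp add: has_bochner_integral_iff Y_def numeral_2_eq_2)
qed

section \<open>Polarization identities and matrix-valued integrals\<close>

lemma quadratic_polarization:
  fixes a b :: real
  shows "a * b = ((a + b)\<^sup>2 - (a - b)\<^sup>2) / 4"
  by (simp add: power2_eq_square algebra_simps)

text \<open>Writes the monomials of the mixed fourth moment as a combination of pure fourth powers, so that
  only moments of one-dimensional Gaussians are needed and no Isserlis formula.\<close>

lemma quartic_polarization:
  fixes a b c :: real
  shows "a\<^sup>2 * (b * c) =
    ((a + b + c) ^ 4 + (a - b - c) ^ 4 - (a + b - c) ^ 4 - (a - b + c) ^ 4
      - 2 * (b + c) ^ 4 + 2 * (b - c) ^ 4) / 48"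
  by algebra

text \<open>A matrix is a finite combination of the matrix units \<open>axis i (axis j 1)\<close>
  with its entries as coefficients, so entrywise integrability and values suffice.\<close>

lemma has_bochner_integral_matrix:
  fixes F :: "'w \<Rightarrow> real ^ 'n::finite ^ 'm::finite"
  assumes "\<And>i j. has_bochner_integral M (\<lambda>w. F w $ i $ j) (C $ i $ j)"
  shows "has_bochner_integral M F C"
proof -
  have if_sum: "(\<Sum>j\<in>UNIV. if p then f j else 0) = (if p then sum f UNIV else 0)" for p and f :: "'n \<Rightarrow> real"
    by simp
  have decomp: "D = (\<Sum>i\<in>UNIV. \<Sum>j\<in>UNIV. (D $ i $ j) *\<^sub>R axis i (axis j 1))" for D :: "real ^ 'n ^ 'm"
    by (simp add: vec_eq_iff axis_def if_distrib[of "\<lambda>v. vec_nth v _"] if_distrib[of "\<lambda>t. _ * t"] if_sum cong: if_cong)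
  have "has_bochner_integral M (\<lambda>w. \<Sum>i\<in>UNIV. \<Sum>j\<in>UNIV. (F w $ i $ j) *\<^sub>R axis i (axis j 1))
      (\<Sum>i\<in>UNIV. \<Sum>j\<in>UNIV. (C $ i $ j) *\<^sub>R axis i (axis j (1::real)))"
    by (intro has_bochner_integral_sum has_bochner_integral_scaleR_left assms)
  then show ?thesis
    by (simp only: decomp[symmetric])
qed

locale clustering_model =
  fixes P :: "'w measure"
    and U :: "'k::finite \<Rightarrow> real ^ 'm::finite ^ 'd::finite"
    and \<alpha> :: "'k \<Rightarrow> real" and \<sigma> :: real
    and ix :: "'w \<Rightarrow> 'k" and y \<xi> x :: "'w \<Rightarrow> real ^ 'd"
  assumes model: "subspace_clustering_model P U \<alpha> \<sigma> ix y \<xi> x"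
begin

sublocale prob_space P
  using model by (simp add: subspace_clustering_model_def)

lemma measurables [measurable]:
  "ix \<in> measurable P (count_space UNIV)" "y \<in> borel_measurable P" "\<xi> \<in> borel_measurable P"
  using model by (auto simp: subspace_clustering_model_def indep_vars3_def)

lemma indep: "indep_vars3 P (count_space UNIV) ix borel y borel \<xi>"
  and ortho: "transpose (U i) ** U i = mat 1"
  and weight_pos: "\<alpha> i > 0"
  and weight_sum: "(\<Sum>i\<in>UNIV. \<alpha> i) = 1"
  and prob_ix: "prob {w \<in> space P. ix w = i} = \<alpha> i"
  and x_eq: "w \<in> space P \<Longrightarrow> x w = (U (ix w) ** transpose (U (ix w))) *v y w + \<xi> w"
  using model by (auto simp: subspace_clustering_model_def orthonormal_columns_def)

lemma y_law: "distr P borel y = isotropic_gaussian 1"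
  and \<xi>_law: "distr P borel \<xi> = isotropic_gaussian (\<sigma>\<^sup>2)"
  using model by (auto simp: subspace_clustering_model_def)

lemmas y_moments = isotropic_gaussian_inner_moments[OF measurables(2) y_law, simplified]
lemmas \<xi>_moments = isotropic_gaussian_inner_moments[OF measurables(3) \<xi>_law, simplified]

section \<open>The components: projections, covariances and moments\<close>

abbreviation proj :: "'k \<Rightarrow> real ^ 'd ^ 'd" where
  "proj i \<equiv> U i ** transpose (U i)"

text \<open>The covariance of \<open>x\<close> given \<open>ix = i\<close>: since
  \<open>proj i\<close> is symmetric and idempotent, it is the covariance of
  \<open>proj i *v y\<close>, to which the noise adds its own.\<close>

definition cov :: "'k \<Rightarrow> real ^ 'd ^ 'd" where
  "cov i = proj i + \<sigma>\<^sup>2 *\<^sub>R mat 1"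

lemma transpose_proj: "transpose (proj i) = proj i"
  by (simp add: matrix_transpose_mul)

lemma inner_proj: "u \<bullet> (proj i *v w) = (proj i *v u) \<bullet> w"
  using matrix_vector_mult_adjoint[of u "proj i" w] by (simp add: transpose_proj)

lemma inner_proj_eq: "u \<bullet> (proj i *v u) = (norm (transpose (U i) *v u))\<^sup>2"
  unfolding matrix_vector_mul_assoc[symmetric] matrix_vector_mult_adjoint[of u "U i"] power2_norm_eq_inner ..

lemma proj_idem: "proj i *v (proj i *v u) = proj i *v u"
proof -
  have "proj i ** proj i = U i ** (transpose (U i) ** U i) ** transpose (U i)"
    by (simp only: matrix_mul_assoc)
  then show ?thesis
    by (simp add: matrix_vector_mul_assoc ortho)
qed

lemma norm_proj_squared: "(norm (proj i *v u))\<^sup>2 = u \<bullet> (proj i *v u)"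
  using inner_proj[of u i "proj i *v u"] by (simp add: power2_norm_eq_inner proj_idem)

lemma cov_mult: "cov i *v u = proj i *v u + \<sigma>\<^sup>2 *\<^sub>R u"
  by (simp add: cov_def matrix_vector_mult_add_rdistrib scaleR_matrix_vector_assoc[symmetric])

lemma inner_cov: "u \<bullet> (cov i *v w) = w \<bullet> (cov i *v u)"
  using inner_proj[of u i w] by (simp add: cov_mult inner_add_right inner_commute)

lemma inner_cov_self: "u \<bullet> (cov i *v u) = (norm (proj i *v u))\<^sup>2 + \<sigma>\<^sup>2 * (norm u)\<^sup>2"
  by (simp add: cov_mult inner_add_right norm_proj_squared power2_norm_eq_inner[of u])

text \<open>Where \<open>ix w = i\<close>, the inner product of \<open>x w\<close> with
  \<open>u\<close> is a sum of a \<open>y\<close> part and a \<open>\<xi>\<close> part. The binomial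
  theorem expands its power and independence factors each term. The indicator replaces conditioning,
  whence the factor \<open>\<alpha> i\<close>.\<close>

lemma component_power_integral:
  "has_bochner_integral P (\<lambda>w. indicat_real {i} (ix w) * (x w \<bullet> u) ^ n)
    (\<alpha> i * (\<Sum>l\<le>n. of_nat (n choose l) * ((\<integral>w. (y w \<bullet> (proj i *v u)) ^ l \<partial>P) * (\<integral>w. (\<xi> w \<bullet> u) ^ (n - l) \<partial>P))))"
proof -
  let ?p = "proj i *v u"
  have "has_bochner_integral P (\<lambda>w. indicat_real {i} (ix w) * ((y w \<bullet> ?p) ^ l * (\<xi> w \<bullet> u) ^ (n - l)))
    (\<alpha> i * ((\<integral>w. (y w \<bullet> ?p) ^ l \<partial>P) * (\<integral>w. (\<xi> w \<bullet> u) ^ (n - l) \<partial>P)))" for l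
  proof -
    have eq: "(\<lambda>w. indicat_real {i} (ix w)) = (\<lambda>w. indicat_real (ix -` {i}) w)"
      by (auto simp: indicator_def)
    have "integrable P (\<lambda>w. indicat_real {i} (ix w))"
      by (intro integrable_const_bound[of _ 1]) (auto simp: indicator_def)
    moreover have "(\<integral>w. indicat_real {i} (ix w) \<partial>P) = \<alpha> i"
      using prob_ix[of i] by (simp add: eq vimage_def Int_def conj_commute)
    ultimately show ?thesis
      using indep_vars3_integral[OF indep, of "indicat_real {i}" "\<lambda>z. (z \<bullet> ?p) ^ l" "\<lambda>z. (z \<bullet> u) ^ (n - l)"]
      by (simp add: y_moments(1) \<xi>_moments(1))
  qed
  then have "has_bochner_integral P (\<lambda>w. \<Sum>l\<le>n. of_nat (n choose l) * (indicat_real {i} (ix w) * ((y w \<bullet> ?p) ^ l * (\<xi> w \<bullet> u) ^ (n - l))))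
    (\<Sum>l\<le>n. of_nat (n choose l) * (\<alpha> i * ((\<integral>w. (y w \<bullet> ?p) ^ l \<partial>P) * (\<integral>w. (\<xi> w \<bullet> u) ^ (n - l) \<partial>P))))"
    by (intro has_bochner_integral_sum has_bochner_integral_mult_right)
  moreover have "indicat_real {i} (ix w) * (x w \<bullet> u) ^ n = (\<Sum>l\<le>n. of_nat (n choose l) * (indicat_real {i} (ix w) * ((y w \<bullet> ?p) ^ l * (\<xi> w \<bullet> u) ^ (n - l))))"
    if "w \<in> space P" for w
  proof (cases "ix w = i")
    case True
    \<comment> \<open>The projection moves from \<open>y w\<close> to \<open>u\<close> by symmetry,
      which leaves a one-dimensional marginal of \<open>y\<close>.\<close>
    have "x w \<bullet> u = y w \<bullet> ?p + \<xi> w \<bullet> u"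
      using x_eq[OF that] True inner_proj[of u i "y w"]
      by (simp add: inner_simps inner_commute)
    with True show ?thesis by (simp add: binomial_ring mult.assoc)
  qed simp
  ultimately show ?thesis
    by (simp add: sum_distrib_left mult.left_commute cong: has_bochner_integral_cong)
qed

lemma component_moments:
  shows "has_bochner_integral P (\<lambda>w. indicat_real {i} (ix w) * (x w \<bullet> u)\<^sup>2) (\<alpha> i * (u \<bullet> (cov i *v u)))"
    and "has_bochner_integral P (\<lambda>w. indicat_real {i} (ix w) * (x w \<bullet> u) ^ 4) (\<alpha> i * (3 * (u \<bullet> (cov i *v u))\<^sup>2))"
proof -
  have sums: "(\<Sum>l\<le>2. F l) = F 0 + F 1 + F 2" "(\<Sum>l\<le>4. F l) = F 0 + F 1 + F 2 + F 3 + F 4" for F :: "nat \<Rightarrow> real"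
    by (simp_all add: numeral_eq_Suc)
  show "has_bochner_integral P (\<lambda>w. indicat_real {i} (ix w) * (x w \<bullet> u)\<^sup>2) (\<alpha> i * (u \<bullet> (cov i *v u)))"
    using component_power_integral[of i u 2] unfolding sums
    by (simp add: y_moments \<xi>_moments prob_space inner_cov_self add.commute)
  \<comment> \<open>The odd moments vanish. With variances p and s of the two parts, what remains is
    3 p^2 + 6 p s + 3 s^2 = 3 (p + s)^2.\<close>
  have "(4 choose 2) = (6 :: nat)" by (simp add: choose_two)
  then show "has_bochner_integral P (\<lambda>w. indicat_real {i} (ix w) * (x w \<bullet> u) ^ 4) (\<alpha> i * (3 * (u \<bullet> (cov i *v u))\<^sup>2))"
    using component_power_integral[of i u 4] unfolding sums
    by (simp add: y_moments \<xi>_moments prob_space inner_cov_self power2_sum algebra_simps)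
qed

lemma component_mixed_moments:
  shows "has_bochner_integral P (\<lambda>w. indicat_real {i} (ix w) * ((x w \<bullet> b) * (x w \<bullet> c))) (\<alpha> i * (b \<bullet> (cov i *v c)))"
    and "has_bochner_integral P (\<lambda>w. indicat_real {i} (ix w) * ((x w \<bullet> a)\<^sup>2 * ((x w \<bullet> b) * (x w \<bullet> c))))
      (\<alpha> i * ((a \<bullet> (cov i *v a)) * (b \<bullet> (cov i *v c)) + 2 * (a \<bullet> (cov i *v b)) * (a \<bullet> (cov i *v c))))"
proof -
  let ?I = "\<lambda>w. indicat_real {i} (ix w)"
  \<comment> \<open>Treating the covariance as an abstract symmetric bilinear form reduces the
    values of both polarized integrals to polynomial identities in its entries.\<close>
  define q where "q u w = u \<bullet> (cov i *v w)" for u w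
  have q_lin: "q (u + u') w = q u w + q u' w" "q (u - u') w = q u w - q u' w"
    "q w (u + u') = q w u + q w u'" "q w (u - u') = q w u - q w u'" for u u' w
    by (simp_all only: q_def matrix_vector_right_distrib matrix_vector_mult_diff_distrib
        inner_add_left inner_add_right inner_diff_left inner_diff_right)
  have q_sym: "q b a = q a b" "q c a = q a c" "q c b = q b c"
    by (simp_all only: q_def inner_cov[of b i a] inner_cov[of c i a] inner_cov[of c i b])
  note moments = component_moments[where i = i, folded q_def]
  have "has_bochner_integral P (\<lambda>w. (?I w * (x w \<bullet> (b + c))\<^sup>2 - ?I w * (x w \<bullet> (b - c))\<^sup>2) / 4)
    ((\<alpha> i * q (b + c) (b + c) - \<alpha> i * q (b - c) (b - c)) / 4)"
    by (intro has_bochner_integral_divide_zero has_bochner_integral_diff moments)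
  moreover have "\<alpha> i * q (b + c) (b + c) - \<alpha> i * q (b - c) (b - c) = 4 * (\<alpha> i * q b c)"
    unfolding q_lin q_sym by algebra
  moreover have "(?I w * (x w \<bullet> (b + c))\<^sup>2 - ?I w * (x w \<bullet> (b - c))\<^sup>2) / 4 = ?I w * ((x w \<bullet> b) * (x w \<bullet> c))" for w
    unfolding inner_add_right inner_diff_right quadratic_polarization[of "x w \<bullet> b"]
    by (simp add: right_diff_distrib)
  ultimately show "has_bochner_integral P (\<lambda>w. ?I w * ((x w \<bullet> b) * (x w \<bullet> c))) (\<alpha> i * (b \<bullet> (cov i *v c)))"
    by (simp add: q_def)
  have "has_bochner_integral P
    (\<lambda>w. (?I w * (x w \<bullet> (a + b + c)) ^ 4 + ?I w * (x w \<bullet> (a - b - c)) ^ 4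
      - ?I w * (x w \<bullet> (a + b - c)) ^ 4 - ?I w * (x w \<bullet> (a - b + c)) ^ 4
      - 2 * (?I w * (x w \<bullet> (b + c)) ^ 4) + 2 * (?I w * (x w \<bullet> (b - c)) ^ 4)) / 48)
    ((\<alpha> i * (3 * (q (a + b + c) (a + b + c))\<^sup>2) + \<alpha> i * (3 * (q (a - b - c) (a - b - c))\<^sup>2)
      - \<alpha> i * (3 * (q (a + b - c) (a + b - c))\<^sup>2) - \<alpha> i * (3 * (q (a - b + c) (a - b + c))\<^sup>2)
      - 2 * (\<alpha> i * (3 * (q (b + c) (b + c))\<^sup>2)) + 2 * (\<alpha> i * (3 * (q (b - c) (b - c))\<^sup>2))) / 48)"
    (is "has_bochner_integral P ?f (?m / 48)")
    by (intro has_bochner_integral_divide_zero has_bochner_integral_diff has_bochner_integral_add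
        has_bochner_integral_mult_right moments)
  moreover have "?f w = ?I w * ((x w \<bullet> a)\<^sup>2 * ((x w \<bullet> b) * (x w \<bullet> c)))" for w
    unfolding inner_add_right inner_diff_right quartic_polarization
    by (simp add: algebra_simps)
  moreover have "?m = 48 * (\<alpha> i * (q a a * q b c + 2 * q a b * q a c))"
    unfolding q_lin q_sym by algebra
  ultimately show "has_bochner_integral P (\<lambda>w. ?I w * ((x w \<bullet> a)\<^sup>2 * ((x w \<bullet> b) * (x w \<bullet> c))))
      (\<alpha> i * ((a \<bullet> (cov i *v a)) * (b \<bullet> (cov i *v c)) + 2 * (a \<bullet> (cov i *v b)) * (a \<bullet> (cov i *v c))))"
    by (simp add: q_def)
qed

text \<open>Law of total expectation: exactly one of the indicators is 1 at each point.\<close>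

lemma has_bochner_integral_sum_components:
  assumes "\<And>i. has_bochner_integral P (\<lambda>w. indicat_real {i} (ix w) * f w) (m i)"
  shows "has_bochner_integral P f (\<Sum>i\<in>UNIV. m i)"
proof -
  have "has_bochner_integral P (\<lambda>w. \<Sum>i\<in>UNIV. indicat_real {i} (ix w) * f w) (\<Sum>i\<in>UNIV. m i)"
    by (intro has_bochner_integral_sum assms)
  moreover have "(\<Sum>i\<in>UNIV. indicat_real {i} (ix w) * f w) = f w" for w
    by (simp add: sum_distrib_right[symmetric] indicator_def)
  ultimately show ?thesis by simp
qed

lemma second_moment:
  "has_bochner_integral P (\<lambda>w. outer_prod (x w) (x w)) (\<Sum>i\<in>UNIV. \<alpha> i *\<^sub>R cov i)"
proof (rule has_bochner_integral_matrix)
  fix a b :: 'd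
  show "has_bochner_integral P (\<lambda>w. outer_prod (x w) (x w) $ a $ b) ((\<Sum>i\<in>UNIV. \<alpha> i *\<^sub>R cov i) $ a $ b)"
    using has_bochner_integral_sum_components[OF component_mixed_moments(1)[of _ "axis a 1" "axis b 1"]]
    by (simp add: inner_axis inner_axis' matrix_vector_mult_basis column_def outer_prod_def)
qed

lemma fourth_moment:
  "has_bochner_integral P (\<lambda>w. (x w \<bullet> v)\<^sup>2 *\<^sub>R outer_prod (x w) (x w))
     (\<Sum>i\<in>UNIV. \<alpha> i *\<^sub>R ((v \<bullet> (cov i *v v)) *\<^sub>R cov i + 2 *\<^sub>R outer_prod (cov i *v v) (cov i *v v)))"
proof (rule has_bochner_integral_matrix)
  fix a b :: 'd
  \<comment> \<open>Symmetry of the covariance turns a pairing with a basis vector into an entry of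
    \<open>cov i *v v\<close>, the form needed for the outer product.\<close>
  have "v \<bullet> (cov i *v axis a 1) = (cov i *v v) $ a" for i a
    by (subst inner_cov) (simp add: inner_axis')
  then show "has_bochner_integral P (\<lambda>w. ((x w \<bullet> v)\<^sup>2 *\<^sub>R outer_prod (x w) (x w)) $ a $ b)
     ((\<Sum>i\<in>UNIV. \<alpha> i *\<^sub>R ((v \<bullet> (cov i *v v)) *\<^sub>R cov i + 2 *\<^sub>R outer_prod (cov i *v v) (cov i *v v))) $ a $ b)"
    using has_bochner_integral_sum_components[OF component_mixed_moments(2)[of _ v "axis a 1" "axis b 1"]]
    by (simp add: inner_axis inner_axis' matrix_vector_mult_basis column_def outer_prod_def mult.assoc)
qed

section \<open>The averaged projection and the expansion of the fourth moment\<close>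

lemma sum_cov: "(\<Sum>i\<in>UNIV. \<alpha> i *\<^sub>R cov i) = (\<Sum>i\<in>UNIV. \<alpha> i *\<^sub>R proj i) + \<sigma>\<^sup>2 *\<^sub>R mat 1"
proof -
  have "(\<Sum>i\<in>UNIV. \<alpha> i *\<^sub>R cov i) = (\<Sum>i\<in>UNIV. \<alpha> i *\<^sub>R proj i) + (\<Sum>i\<in>UNIV. \<alpha> i) *\<^sub>R \<sigma>\<^sup>2 *\<^sub>R mat 1"
    by (simp add: cov_def scaleR_add_right sum.distrib scaleR_sum_left[symmetric] sum_distrib_right[symmetric])
  then show ?thesis by (simp add: weight_sum)
qed

lemma sum_proj_mult: "(\<Sum>i\<in>UNIV. \<alpha> i *\<^sub>R proj i) *v u = (\<Sum>i\<in>UNIV. \<alpha> i *\<^sub>R (proj i *v u))"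
proof -
  have lin: "linear (\<lambda>M :: real ^ 'd ^ 'd. M *v u)"
    by (intro linearI) (simp_all add: matrix_vector_mult_add_rdistrib scaleR_matrix_vector_assoc)
  show ?thesis
    by (simp only: linear_sum[OF lin] linear_cmul[OF lin])
qed

lemma transpose_sum_proj: "transpose (\<Sum>i\<in>UNIV. \<alpha> i *\<^sub>R proj i) = (\<Sum>i\<in>UNIV. \<alpha> i *\<^sub>R proj i)"
proof -
  have "proj i $ a $ b = proj i $ b $ a" for i a b
    using arg_cong[OF transpose_proj[of i], of "\<lambda>M. M $ a $ b"] by (simp add: transpose_def)
  then show ?thesis by (simp add: vec_eq_iff transpose_def)
qed

lemma sum_proj_psd: "u \<bullet> ((\<Sum>i\<in>UNIV. \<alpha> i *\<^sub>R proj i) *v u) \<ge> 0"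
  unfolding sum_proj_mult inner_sum_right inner_scaleR_right inner_proj_eq
  by (intro sum_nonneg mult_nonneg_nonneg) (auto intro: less_imp_le weight_pos)

text \<open>Every \<open>U i *v z\<close> is a combination of the columns of \<open>U i\<close>.
  Columns of different components may coincide, so their number is only bounded by the number of
  pairs.\<close>

lemma dim_range_sum_proj: "dim (range ((*v) (\<Sum>i\<in>UNIV. \<alpha> i *\<^sub>R proj i))) \<le> CARD('m) * CARD('k)"
proof -
  let ?W = "(\<lambda>(i, c). column c (U i)) ` (UNIV :: ('k \<times> 'm) set)"
  have "U i *v z \<in> span ?W" for i z
    unfolding matrix_mult_sum vector_scalar_mult_def[symmetric] scalar_mult_eq_scaleR
    by (intro span_sum span_scale span_base) auto
  then have "range ((*v) (\<Sum>i\<in>UNIV. \<alpha> i *\<^sub>R proj i)) \<subseteq> span ?W"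
    by (auto simp: sum_proj_mult matrix_vector_mul_assoc[symmetric] intro!: span_sum span_scale)
  then have "dim (range ((*v) (\<Sum>i\<in>UNIV. \<alpha> i *\<^sub>R proj i))) \<le> card ?W"
    by (intro dim_le_card) auto
  also have "card ?W \<le> card (UNIV :: ('k \<times> 'm) set)"
    by (rule card_image_le) simp
  finally show ?thesis by (simp add: mult.commute)
qed

lemma outer_prod_mult_left: "M ** outer_prod u w = outer_prod (M *v u) w"
  by (simp add: outer_prod_def vec_eq_iff matrix_matrix_mult_def matrix_vector_mult_def sum_distrib_right mult.assoc)

lemma outer_prod_mult_right: "outer_prod u w ** M = outer_prod u (transpose M *v w)"
  by (simp add: outer_prod_def vec_eq_iff matrix_matrix_mult_def matrix_vector_mult_def transpose_def
      sum_distrib_left mult_ac)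

text \<open>Substituting \<open>proj i\<close> plus noise for \<open>cov i\<close> and sorting by
  powers of \<open>\<sigma>\<close>: the first two terms are the contribution to \<open>B\<close>,
  and the others average to its correction terms, in the same order.\<close>

lemma component_identity:
  "(v \<bullet> (cov i *v v)) *\<^sub>R cov i + 2 *\<^sub>R outer_prod (cov i *v v) (cov i *v v)
   = (norm (transpose (U i) *v v))\<^sup>2 *\<^sub>R proj i + 2 *\<^sub>R outer_prod (proj i *v v) (proj i *v v)
     + (\<sigma>\<^sup>2 * (v \<bullet> (proj i *v v))) *\<^sub>R mat 1 + (\<sigma>\<^sup>2 * (norm v)\<^sup>2) *\<^sub>R proj i
     + \<sigma> ^ 4 *\<^sub>R ((norm v)\<^sup>2 *\<^sub>R mat 1 + 2 *\<^sub>R outer_prod v v)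
     + (2 * \<sigma>\<^sup>2) *\<^sub>R (outer_prod (proj i *v v) v + outer_prod v (proj i *v v))"
proof -
  have "v \<bullet> (cov i *v v) = v \<bullet> (proj i *v v) + \<sigma>\<^sup>2 * (norm v)\<^sup>2"
    by (simp add: cov_mult inner_add_right power2_norm_eq_inner)
  moreover have "\<sigma> ^ 4 = \<sigma>\<^sup>2 * \<sigma>\<^sup>2" by (simp add: power2_eq_square power4_eq_xxxx)
  ultimately show ?thesis
    unfolding inner_proj_eq[symmetric] cov_mult
    by (simp add: cov_def vec_eq_iff outer_prod_def power2_norm_eq_inner[of v] algebra_simps)
qed

end

theorem theorem13:
  fixes P :: "'w measure"
    and U :: "'k::finite \<Rightarrow> real ^ 'm::finite ^ 'd::finite"
    and \<alpha> :: "'k \<Rightarrow> real"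
    and \<sigma> :: real
    and ix :: "'w \<Rightarrow> 'k"
    and y \<xi> x :: "'w \<Rightarrow> real ^ 'd"
    and v :: "real ^ 'd"
    and M\<^sub>2 A B :: "real ^ 'd ^ 'd"
  assumes model: "subspace_clustering_model P U \<alpha> \<sigma> ix y \<xi> x"
    and dim: "CARD('d) > CARD('m) * CARD('k)"
    and M\<^sub>2_def: "M\<^sub>2 = (\<integral>w. outer_prod (x w) (x w) \<partial>P)"
    and A_def: "A = M\<^sub>2 - \<sigma>\<^sup>2 *\<^sub>R mat 1"
    and B_def: "B = (\<integral>w. (x w \<bullet> v)\<^sup>2 *\<^sub>R outer_prod (x w) (x w) \<partial>P)
           - (\<sigma>\<^sup>2 * (v \<bullet> (A *v v))) *\<^sub>R mat 1
           - (\<sigma>\<^sup>2 * (norm v)\<^sup>2) *\<^sub>R A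
           - \<sigma>^4 *\<^sub>R ((norm v)\<^sup>2 *\<^sub>R mat 1 + 2 *\<^sub>R outer_prod v v)
           - (2 * \<sigma>\<^sup>2) *\<^sub>R (A ** outer_prod v v + outer_prod v v ** A)"
  shows "\<sigma>\<^sup>2 = singular_value (CARD('m) * CARD('k) + 1) M\<^sub>2
       \<and> A = (\<Sum>i\<in>UNIV. \<alpha> i *\<^sub>R (U i ** transpose (U i)))
       \<and> B = (\<Sum>i\<in>UNIV. (\<alpha> i * (norm (transpose (U i) *v v))\<^sup>2) *\<^sub>R (U i ** transpose (U i)))
           + 2 *\<^sub>R (\<Sum>i\<in>UNIV. \<alpha> i *\<^sub>R
               (U i ** transpose (U i) ** outer_prod v v ** U i ** transpose (U i)))"
proof -
  interpret clustering_model P U \<alpha> \<sigma> ix y \<xi> x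
    by unfold_locales (rule model)
  have M2: "M\<^sub>2 = (\<Sum>i\<in>UNIV. \<alpha> i *\<^sub>R proj i) + \<sigma>\<^sup>2 *\<^sub>R mat 1"
    using second_moment by (simp add: M\<^sub>2_def has_bochner_integral_iff sum_cov)
  then have A: "A = (\<Sum>i\<in>UNIV. \<alpha> i *\<^sub>R proj i)"
    by (simp add: A_def)
  have "\<sigma>\<^sup>2 = singular_value (CARD('m) * CARD('k) + 1) M\<^sub>2"
    unfolding M2
    by (rule singular_value_low_rank_plus_identity[symmetric])
       (simp_all add: transpose_sum_proj sum_proj_psd dim_range_sum_proj dim)
  \<comment> \<open>The right factor acts on the second vector through its transpose, which yields
    the same projection again.\<close>
  have sandwich: "U i ** transpose (U i) ** outer_prod v v ** U i ** transpose (U i) = outer_prod (proj i *v v) (proj i *v v)" for i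
    unfolding outer_prod_mult_left outer_prod_mult_right
    by (simp only: matrix_vector_mul_assoc transpose_transpose)
  have Av: "A *v v = (\<Sum>i\<in>UNIV. \<alpha> i *\<^sub>R (proj i *v v))"
    unfolding A by (rule sum_proj_mult)
  have AT: "transpose A = A"
    unfolding A by (rule transpose_sum_proj)
  have outer_sum: "outer_prod (\<Sum>i\<in>UNIV. \<alpha> i *\<^sub>R f i) v = (\<Sum>i\<in>UNIV. \<alpha> i *\<^sub>R outer_prod (f i) v)"
    "outer_prod v (\<Sum>i\<in>UNIV. \<alpha> i *\<^sub>R f i) = (\<Sum>i\<in>UNIV. \<alpha> i *\<^sub>R outer_prod v (f i))" for f :: "'k \<Rightarrow> real ^ 'd"
    by (simp_all add: outer_prod_def vec_eq_iff sum_distrib_left sum_distrib_right mult_ac)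
  \<comment> \<open>The weights sum to 1, so terms independent of the component survive averaging
    unchanged.\<close>
  have const: "(\<Sum>i\<in>UNIV. \<alpha> i *\<^sub>R C) = C" for C :: "real ^ 'd ^ 'd"
    by (simp add: scaleR_left.sum[symmetric] weight_sum)
  have pull: "(\<Sum>i\<in>UNIV. \<alpha> i *\<^sub>R (c *\<^sub>R F i)) = c *\<^sub>R (\<Sum>i\<in>UNIV. \<alpha> i *\<^sub>R F i)" for c and F :: "'k \<Rightarrow> real ^ 'd ^ 'd"
    by (simp add: scaleR_sum_right mult.commute)
  have trace: "(\<Sum>i\<in>UNIV. \<alpha> i *\<^sub>R ((\<sigma>\<^sup>2 * (v \<bullet> (proj i *v v))) *\<^sub>R mat 1)) = (\<sigma>\<^sup>2 * (v \<bullet> (A *v v))) *\<^sub>R (mat 1 :: real ^ 'd ^ 'd)"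
    unfolding Av by (simp add: inner_sum_right sum_distrib_left scaleR_left.sum mult_ac)
  \<comment> \<open>The average of \<open>component_identity\<close>, with the sums over components
    collected into \<open>A\<close>.\<close>
  have "(\<integral>w. (x w \<bullet> v)\<^sup>2 *\<^sub>R outer_prod (x w) (x w) \<partial>P)
     = (\<Sum>i\<in>UNIV. \<alpha> i *\<^sub>R ((norm (transpose (U i) *v v))\<^sup>2 *\<^sub>R proj i))
       + 2 *\<^sub>R (\<Sum>i\<in>UNIV. \<alpha> i *\<^sub>R outer_prod (proj i *v v) (proj i *v v))
       + (\<sigma>\<^sup>2 * (v \<bullet> (A *v v))) *\<^sub>R mat 1 + (\<sigma>\<^sup>2 * (norm v)\<^sup>2) *\<^sub>R A
       + \<sigma> ^ 4 *\<^sub>R ((norm v)\<^sup>2 *\<^sub>R mat 1 + 2 *\<^sub>R outer_prod v v)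
       + (2 * \<sigma>\<^sup>2) *\<^sub>R (outer_prod (A *v v) v + outer_prod v (A *v v))"
    unfolding fourth_moment[THEN has_bochner_integral_integral_eq] component_identity
      scaleR_add_right[of "\<alpha> _"] sum.distrib trace const pull outer_sum Av
    unfolding A scaleR_add_right ..
  \<comment> \<open>By symmetry of \<open>A\<close>, the products of \<open>A\<close> with
    \<open>outer_prod v v\<close> are outer products of \<open>A *v v\<close> and \<open>v\<close>;
    every correction term then cancels.\<close>
  then have "B = (\<Sum>i\<in>UNIV. \<alpha> i *\<^sub>R ((norm (transpose (U i) *v v))\<^sup>2 *\<^sub>R proj i))
       + 2 *\<^sub>R (\<Sum>i\<in>UNIV. \<alpha> i *\<^sub>R outer_prod (proj i *v v) (proj i *v v))"
    unfolding B_def outer_prod_mult_left outer_prod_mult_right AT by simp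
  then show ?thesis
    using \<open>\<sigma>\<^sup>2 = _\<close> A by (simp add: sandwich)
qed

end
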